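(* Let $A\in\mathbb{R}^{d\times d}$, let $S:\mathbb{R}^d\to\mathbb{R}^{d\times d}$ be a matrix function, and let $V:\mathbb{R}^d\to\mathbb{R}$ be a function, such that the linear gradient DAE $A\dot z=S(z)\nabla V(z)$ is regular with configuration space $\mathcal{M}$, and $V$ is proper for this DAE. Then $V$ is a conserved quantity of this DAE if $A^\dagger S(z)$ is skew-symmetric for every $z\in\mathcal{M}$.
   Context: $A^\dagger$ is the Moore--Penrose inverse of $A$; $A$ may be singular. A DAE $A\dot z=f(z)$ (here with $f(z)=S(z)\nabla V(z)$) is called regular if there are a differentiable submanifold $\mathcal{M}$ of $\mathbb{R}^d$ (the configuration space) and a vector field $v:\mathcal{M}\to T\mathcal{M}$ such that a differentiable map $w:[0,T)\to\mathcal{M}$ is a solution of $\dot w=v(w)$ if and only if $z=j\circ w$ is a solution of the DAE, where $j:\mathcal{M}\to\mathbb{R}^d$ is the inclusion. In particular all solutions lie in $\mathcal{M}$. Let $\mathrm{car}(A)=\mathrm{null}(A)^\perp$. A differentiable function $V$ is proper for the DAE if $\nabla V(z)\in\mathrm{car}(A)$ for every $z\in\mathcal{M}$. A $C^r$ function $V$ ($r\ge1$, $d>1$) is a conserved quantity of the DAE if $\frac{d}{dt}V(z(t))=0$ for every solution $z$ of the DAE. *)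

theory Defs
  imports "HOL-Analysis.Analysis"
begin

section \<open>Linear algebra\<close>

definition is_moore_penrose :: "real^'n^'m \<Rightarrow> real^'m^'n \<Rightarrow> bool" where
  "is_moore_penrose A X \<longleftrightarrow>
     A ** X ** A = A \<and> X ** A ** X = X \<and>
     transpose (A ** X) = A ** X \<and> transpose (X ** A) = X ** A"

text \<open>The four Penrose equations have exactly one solution for every real matrix, so the
  definite description below always denotes.\<close>

definition pinv :: "real^'n^'m \<Rightarrow> real^'m^'n" where
  "pinv A = (THE X. is_moore_penrose A X)"

definition skew_symmetric :: "real^'n^'n \<Rightarrow> bool" where
  "skew_symmetric B \<longleftrightarrow> transpose B = - B"

definition car :: "real^'n^'m \<Rightarrow> (real^'n) set" where
  "car A = orthogonal_comp {x. A *v x = 0}"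

section \<open>Gradients and functions of class C^r\<close>

text \<open>Meaningful only where \<open>V\<close> is differentiable; the gradient is then unique.\<close>

definition gradient :: "(real^'n \<Rightarrow> real) \<Rightarrow> real^'n \<Rightarrow> real^'n" where
  "gradient V z = (THE g. GDERIV V z :> g)"

fun class_C :: "nat \<Rightarrow> (real^'n \<Rightarrow> real) \<Rightarrow> bool" where
  "class_C 0 V \<longleftrightarrow> continuous_on UNIV V"
| "class_C (Suc r) V \<longleftrightarrow>
     V differentiable_on UNIV \<and>
     (\<forall>i. class_C r (\<lambda>z. frechet_derivative V (at z) (axis i 1)))"

section \<open>Submanifolds of Euclidean space\<close>

definition C1_map_on :: "('a::real_normed_vector \<Rightarrow> 'b::real_normed_vector) \<Rightarrow> 'a set \<Rightarrow> bool" where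
  "C1_map_on f U \<longleftrightarrow>
     (\<exists>f' :: 'a \<Rightarrow> 'a \<Rightarrow>\<^sub>L 'b.
        (\<forall>x\<in>U. (f has_derivative blinfun_apply (f' x)) (at x)) \<and> continuous_on U f')"

text \<open>Embedded \<open>k\<close>-dimensional submanifolds of class C^1: near each point of \<open>M\<close> some
  C^1-diffeomorphism \<open>\<phi>\<close> between open sets (with inverse \<open>\<psi>\<close>) flattens \<open>M\<close> onto a piece of a
  \<open>k\<close>-dimensional linear subspace. Smoother submanifolds are special cases.\<close>

definition differentiable_submanifold :: "nat \<Rightarrow> 'a::euclidean_space set \<Rightarrow> bool" where
  "differentiable_submanifold k M \<longleftrightarrow>
     (\<forall>p\<in>M. \<exists>U W L \<phi> \<psi>.
        open U \<and> open W \<and> p \<in> U \<and> subspace L \<and> dim L = k \<and>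
        homeomorphism U W \<phi> \<psi> \<and> C1_map_on \<phi> U \<and> C1_map_on \<psi> W \<and>
        \<phi> ` (M \<inter> U) = W \<inter> (L :: 'a set))"

text \<open>Tangent vectors are the velocities at \<open>p\<close> of curves in \<open>M\<close>, regarded as vectors of the
  ambient space.\<close>

definition tangent_space :: "'a::euclidean_space set \<Rightarrow> 'a \<Rightarrow> 'a set" where
  "tangent_space M p =
     {u. \<exists>\<gamma> \<epsilon>. 0 < \<epsilon> \<and> \<gamma> 0 = p \<and> (\<forall>t::real. \<bar>t\<bar> < \<epsilon> \<longrightarrow> \<gamma> t \<in> M) \<and>
         (\<gamma> has_vector_derivative u) (at 0)}"

definition vector_field_on :: "'a::euclidean_space set \<Rightarrow> ('a \<Rightarrow> 'a) \<Rightarrow> bool" where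
  "vector_field_on M v \<longleftrightarrow> (\<forall>p\<in>M. v p \<in> tangent_space M p)"

section \<open>Differential-algebraic equations\<close>

text \<open>The half-open interval \<open>[0,T)\<close>, where \<open>T = \<infinity>\<close> is allowed. Derivatives are taken relative
  to it, hence are one-sided at \<open>0\<close>.\<close>

definition time_dom :: "ereal \<Rightarrow> real set" where
  "time_dom T = {t. 0 \<le> t \<and> ereal t < T}"

definition ode_solution :: "('a::euclidean_space \<Rightarrow> 'a) \<Rightarrow> ereal \<Rightarrow> (real \<Rightarrow> 'a) \<Rightarrow> bool" where
  "ode_solution v T w \<longleftrightarrow>
     (\<forall>t\<in>time_dom T. (w has_vector_derivative v (w t)) (at t within time_dom T))"

definition dae_solution ::
  "real^'n^'n \<Rightarrow> (real^'n \<Rightarrow> real^'n) \<Rightarrow> ereal \<Rightarrow> (real \<Rightarrow> real^'n) \<Rightarrow> bool" where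
  "dae_solution A f T z \<longleftrightarrow>
     (\<forall>t\<in>time_dom T. \<exists>z'. (z has_vector_derivative z') (at t within time_dom T) \<and>
        A *v z' = f (z t))"

text \<open>The submanifold \<open>M\<close> is a set of ambient points, so the inclusion map is not written. The last
  clause, that solutions of the DAE do not leave \<open>M\<close>, is not implied by the equivalence before
  it, which only concerns curves in \<open>M\<close>.\<close>

definition regular_dae ::
  "real^'n^'n \<Rightarrow> (real^'n \<Rightarrow> real^'n) \<Rightarrow> (real^'n) set \<Rightarrow> bool" where
  "regular_dae A f M \<longleftrightarrow>
     (\<exists>k. differentiable_submanifold k M) \<and>
     (\<exists>v. vector_field_on M v \<and>
        (\<forall>T w. 0 < T \<and> w differentiable_on time_dom T \<and> w ` time_dom T \<subseteq> M \<longrightarrow>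
           (ode_solution v T w \<longleftrightarrow> dae_solution A f T w))) \<and>
     (\<forall>T z. 0 < T \<and> dae_solution A f T z \<longrightarrow> z ` time_dom T \<subseteq> M)"

definition proper_for :: "real^'n^'n \<Rightarrow> (real^'n) set \<Rightarrow> (real^'n \<Rightarrow> real) \<Rightarrow> bool" where
  "proper_for A M V \<longleftrightarrow>
     V differentiable_on UNIV \<and> (\<forall>z\<in>M. gradient V z \<in> car A)"

definition conserved_quantity ::
  "nat \<Rightarrow> real^'n^'n \<Rightarrow> (real^'n \<Rightarrow> real^'n) \<Rightarrow> (real^'n \<Rightarrow> real) \<Rightarrow> bool" where
  "conserved_quantity r A f V \<longleftrightarrow>
     1 \<le> r \<and> 1 < CARD('n) \<and> class_C r V \<and>
     (\<forall>T z. 0 < T \<and> dae_solution A f T z \<longrightarrow>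
        (\<forall>t\<in>time_dom T.
           ((\<lambda>s. V (z s)) has_real_derivative 0) (at t within time_dom T)))"

end

theory Submission
  imports Defs
begin

text \<open>Let \<open>z\<close> be a solution and \<open>g = \<nabla>V(z)\<close>. The vector \<open>z' - A\<^sup>\<dagger>Az'\<close> lies in the null space of
  \<open>A\<close>, and \<open>g\<close> is orthogonal to that space because \<open>V\<close> is proper, so the derivative of \<open>V(z)\<close> is
  \<open>z' \<bullet> g = A\<^sup>\<dagger>Az' \<bullet> g = A\<^sup>\<dagger>S(z)g \<bullet> g\<close>. This vanishes by skew-symmetry.\<close>

text \<open>A linear map choosing preimages on the range of \<open>A\<close> supplies
  \<open>K\<close>. This secures only the first Penrose equation; the symmetry conditions come later
  from orthogonal projections.\<close>

lemma generalized_inverse_exists: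
  fixes A :: "real^'n^'m"
  obtains K :: "real^'m^'n" where "A ** K ** A = A"
proof -
  obtain g where g: "linear g" "\<And>v. v \<in> range ((*v) A) \<Longrightarrow> A *v g v = v"
    using linear_exists_right_inverse_on[OF matrix_vector_mul_linear[of A] subspace_UNIV] by blast
  have "A ** matrix g ** A = A"
    unfolding matrix_eq
    by (simp add: matrix_vector_mul_assoc[symmetric] matrix_works linear_matrix_vector_mul_eq g)
  then show thesis by (rule that)
qed

text \<open>\<open>A\<close> and \<open>transpose A ** A\<close> have the same null space: if the
  latter kills \<open>y\<close>, then the squared norm of \<open>A *v y\<close> vanishes.\<close>

lemma gram_cancel:
  fixes A :: "real^'n^'m" and B :: "real^'k^'n"
  assumes "transpose A ** A ** B = transpose A ** A ** C"
  shows "A ** B = A ** C"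
proof -
  have "A *v (B *v x) = A *v (C *v x)" for x
  proof -
    define y where "y = B *v x - C *v x"
    have "transpose A *v (A *v y) = 0"
      using arg_cong[OF assms, of "\<lambda>X. X *v x"]
      by (simp add: y_def matrix_vector_mul_assoc matrix_vector_mult_diff_distrib
          matrix_mul_assoc)
    then have "(A *v y) \<bullet> (A *v y) = 0"
      by (metis dot_lmul_matrix inner_zero_left transpose_matrix_vector)
    then show ?thesis by (simp add: y_def matrix_vector_mult_diff_distrib)
  qed
  then show ?thesis by (simp add: matrix_eq matrix_vector_mul_assoc[symmetric])
qed

text \<open>The matrix \<open>A ** G ** transpose A\<close> is the orthogonal projection onto the range of \<open>A\<close>.\<close>

lemma range_projection_exists:
  fixes A :: "real^'n^'m"
  obtains G :: "real^'n^'n" where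
    "A ** G ** transpose A ** A = A"
    "transpose (A ** G ** transpose A) = A ** G ** transpose A"
proof -
  obtain G where G: "(transpose A ** A) ** G ** (transpose A ** A) = transpose A ** A"
    by (rule generalized_inverse_exists)
  define Q where "Q = A ** G ** transpose A"
  have "A ** (G ** transpose A ** A) = A ** mat 1"
    by (rule gram_cancel) (use G in \<open>simp add: matrix_mul_assoc\<close>)
  then have QA: "Q ** A = A" by (simp add: Q_def matrix_mul_assoc)
  have Qt: "transpose Q = A ** transpose G ** transpose A"
    by (simp add: Q_def matrix_transpose_mul matrix_mul_assoc)
  \<comment> \<open>The columns of \<open>transpose Q\<close> lie in the range of \<open>A\<close>,
    which \<open>Q\<close> fixes. The left side is symmetric, hence so is \<open>Q\<close>.\<close>
  have "Q ** transpose Q = transpose Q"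
    by (simp add: Qt matrix_mul_assoc QA)
  then have "transpose Q = Q"
    by (metis matrix_transpose_mul transpose_transpose)
  with QA show thesis unfolding Q_def by (rule that)
qed

text \<open>A generalized inverse \<open>K\<close> is corrected by orthogonal projections on both
  sides: \<open>Q\<close> onto the range of \<open>A\<close> and \<open>P\<close> onto that of
  \<open>transpose A\<close>. Then \<open>A ** X = Q\<close> and \<open>X ** A = P\<close> are
  symmetric.\<close>

lemma moore_penrose_exists:
  fixes A :: "real^'n^'m"
  shows "\<exists>X. is_moore_penrose A X"
proof -
  obtain K where K: "A ** K ** A = A" by (rule generalized_inverse_exists)
  obtain G where G: "A ** G ** transpose A ** A = A"
    "transpose (A ** G ** transpose A) = A ** G ** transpose A"
    by (rule range_projection_exists)
  obtain H where H: "transpose A ** H ** A ** transpose A = transpose A"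
    "transpose (transpose A ** H ** A) = transpose A ** H ** A"
    using range_projection_exists[of "transpose A"] by auto
  define Q where "Q = A ** G ** transpose A"
  define P where "P = transpose A ** H ** A"
  define X where "X = P ** K ** Q"
  have PA: "P ** transpose A = transpose A" and Pt: "transpose P = P"
    using H by (simp_all add: P_def)
  have QA: "Q ** A = A" and Qt: "transpose Q = Q"
    using G by (simp_all add: Q_def)
  have AP: "A ** P = A"
    by (metis PA Pt matrix_transpose_mul transpose_transpose)
  have "A ** X = A ** K ** Q"
    by (simp add: X_def matrix_mul_assoc AP)
  also have "\<dots> = Q" by (simp add: Q_def matrix_mul_assoc K)
  finally have AX: "A ** X = Q" .
  have "X ** A = P ** K ** A"
    by (simp add: X_def matrix_mul_assoc[symmetric] QA)
  also have "\<dots> = P" by (simp add: P_def matrix_mul_assoc[symmetric] K[unfolded matrix_mul_assoc[symmetric]])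
  finally have XA: "X ** A = P" .
  have "P ** P = P"
    by (metis AP P_def matrix_mul_assoc)
  then have "P ** X = X" by (simp add: X_def matrix_mul_assoc)
  then have "is_moore_penrose A X"
    by (simp add: is_moore_penrose_def AX XA QA Pt Qt)
  then show ?thesis by blast
qed

text \<open>Transposing a product of two symmetric projections swaps its factors, which gives
  \<open>A ** X = A ** Y\<close> and \<open>X ** A = Y ** A\<close>. Then
  \<open>X = X ** A ** X = Y ** A ** Y = Y\<close>.\<close>

lemma moore_penrose_unique:
  assumes "is_moore_penrose A X" "is_moore_penrose A Y"
  shows "X = Y"
proof -
  have X: "A ** X ** A = A" "X ** A ** X = X" "transpose (A ** X) = A ** X" "transpose (X ** A) = X ** A"
    and Y: "A ** Y ** A = A" "Y ** A ** Y = Y" "transpose (A ** Y) = A ** Y" "transpose (Y ** A) = Y ** A"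
    using assms by (auto simp: is_moore_penrose_def)
  have "A ** X = transpose ((A ** Y) ** (A ** X))"
    by (simp add: X(3) Y(1) matrix_mul_assoc)
  also have "\<dots> = (A ** X) ** (A ** Y)"
    by (simp only: matrix_transpose_mul[of "A ** Y"] X(3) Y(3))
  also have "\<dots> = A ** Y"
    by (simp add: matrix_mul_assoc X(1))
  finally have AX: "A ** X = A ** Y" .
  have "X ** A = transpose ((X ** A) ** (Y ** A))"
    by (metis X(4) Y(1) matrix_mul_assoc)
  also have "\<dots> = Y ** A"
    by (metis matrix_transpose_mul X(1,4) Y(4) matrix_mul_assoc)
  finally have XA: "X ** A = Y ** A" .
  show ?thesis by (metis AX XA X(2) Y(2) matrix_mul_assoc)
qed

lemma is_moore_penrose_pinv: "is_moore_penrose A (pinv A)"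
  unfolding pinv_def
  by (rule theI') (use moore_penrose_exists moore_penrose_unique in blast)

text \<open>Riesz representation: the values of the derivative on the basis are the coordinates of
  the gradient. With uniqueness, the definite description in \<open>gradient\<close>
  denotes.\<close>

lemma GDERIV_gradient:
  assumes "V differentiable (at z)"
  shows "GDERIV V z :> gradient V z"
proof -
  obtain D where D: "(V has_derivative D) (at z)"
    using assms by (auto simp: differentiable_def)
  then have "D h = h \<bullet> (\<Sum>b\<in>Basis. D b *\<^sub>R b)" for h
    using linear_sum[OF has_derivative_linear[OF D], of "\<lambda>b. (h \<bullet> b) *\<^sub>R b" Basis]
    by (simp add: euclidean_representation inner_sum_right mult.commute
        linear_scale[OF has_derivative_linear[OF D]])
  then have "D = (\<lambda>h. h \<bullet> (\<Sum>b\<in>Basis. D b *\<^sub>R b))" by blast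
  with D have ex: "GDERIV V z :> (\<Sum>b\<in>Basis. D b *\<^sub>R b)"
    by (simp add: gderiv_def)
  have "g = g'" if "GDERIV V z :> g" "GDERIV V z :> g'" for g g'
    using has_derivative_unique[OF that[unfolded gderiv_def]]
    by (metis vector_eq_ldot)
  with ex show ?thesis unfolding gradient_def by (metis theI)
qed

text \<open>Moving \<open>B\<close> across the inner product turns it into \<open>- B\<close>, so
  the number equals its own negative.\<close>

lemma skew_symmetric_quadratic_form:
  fixes B :: "real^'n^'n"
  assumes "skew_symmetric B"
  shows "(B *v x) \<bullet> x = 0"
proof -
  have "(B *v x) \<bullet> x = x \<bullet> (transpose B *v x)"
    by (metis dot_lmul_matrix inner_commute transpose_matrix_vector)
  also have "transpose B *v x = - (B *v x)"
    using assms matrix_vector_mult_add_rdistrib[of "transpose B" B x]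
    by (simp add: skew_symmetric_def eq_neg_iff_add_eq_0)
  finally show ?thesis by (simp add: inner_commute)
qed

lemma inner_car_pinv:
  assumes "g \<in> car A"
  shows "u \<bullet> g = (pinv A *v (A *v u)) \<bullet> g"
proof -
  have "A ** pinv A ** A = A"
    using is_moore_penrose_pinv by (auto simp: is_moore_penrose_def)
  then have "A *v (u - pinv A *v (A *v u)) = 0"
    by (simp add: matrix_vector_mult_diff_distrib matrix_vector_mul_assoc matrix_mul_assoc)
  with assms have "(u - pinv A *v (A *v u)) \<bullet> g = 0"
    by (auto simp: car_def orthogonal_comp_def orthogonal_def)
  then show ?thesis by (simp add: inner_diff_left)
qed

theorem proposition5p1:
  fixes A :: "real^'n^'n"
    and S :: "real^'n \<Rightarrow> real^'n^'n"
    and V :: "real^'n \<Rightarrow> real"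
    and M :: "(real^'n) set"
    and r :: nat
  assumes "1 < CARD('n)"
    and "1 \<le> r" and "class_C r V"
    and "regular_dae A (\<lambda>z. S z *v gradient V z) M"
    and "proper_for A M V"
    and "\<And>z. z \<in> M \<Longrightarrow> skew_symmetric (pinv A ** S z)"
  shows "conserved_quantity r A (\<lambda>z. S z *v gradient V z) V"
proof -
  have "((\<lambda>s. V (z s)) has_real_derivative 0) (at t within time_dom T)"
    if T: "0 < T" and z: "dae_solution A (\<lambda>z. S z *v gradient V z) T z" and t: "t \<in> time_dom T"
    for T z t
  proof -
    define g where "g = gradient V (z t)"
    obtain u where u: "(z has_vector_derivative u) (at t within time_dom T)" "A *v u = S (z t) *v g"
      using z t by (auto simp: dae_solution_def g_def)
    \<comment> \<open>Regularity confines solutions to \<open>M\<close>, where properness and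
      skew-symmetry are available.\<close>
    have M: "z t \<in> M" using assms(4) T z t unfolding regular_dae_def by blast
    have "u \<bullet> g = ((pinv A ** S (z t)) *v g) \<bullet> g"
      using inner_car_pinv[of g A u] assms(5) M
      by (simp add: proper_for_def g_def[symmetric] u(2) matrix_vector_mul_assoc)
        (simp add: g_def)
    also have "\<dots> = 0" by (rule skew_symmetric_quadratic_form[OF assms(6)[OF M]])
    finally have ug: "u \<bullet> g = 0" .
    have "V differentiable (at (z t))"
      using assms(5) by (simp add: proper_for_def differentiable_on_def)
    then have "(V has_derivative (\<lambda>h. h \<bullet> g)) (at (z t))"
      using GDERIV_gradient by (auto simp: gderiv_def g_def)
    \<comment> \<open>The inner derivative is taken within \<open>time_dom T\<close>, so the chain
      rule also covers the one-sided case at time 0.\<close>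
    from has_derivative_compose[OF u(1)[unfolded has_vector_derivative_def] this]
    show ?thesis by (simp add: has_field_derivative_def ug lambda_zero)
  qed
  with assms(1-3) show ?thesis by (auto simp: conserved_quantity_def)
qed

end
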